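(* Let $0\in R\subseteq \mathbb{R}_{\geq 0}$ be countable, satisfy the 4-values condition and have $0$ as a limit point, let $\boldsymbol{U}_R$ be the countable universal metric space with set of distances $R$, and let $\mathrm{M}=(M;d)$ be the completion of $\boldsymbol{U}_R$. Then $\operatorname{dist}(\mathrm{M})$ is the closure of $R$ in $\mathbb{R}$. Moreover, the set of distances $\operatorname{dist}(\mathrm{N})$ of the completion $\mathrm{N}$ of a universal separable metric space is a closed subset of $\mathbb{R}$.
   Context: For a metric space $\mathrm{M}=(M;d)$ let $\operatorname{dist}(\mathrm{M})=\{d(x,y)\mid x,y\in M\}$. "Countable" means finite or countably infinite. A metric space $\mathrm{M}$ is homogeneous if for every isometry (distance preserving map) $f$ of a finite subspace of $\mathrm{M}$ to a subspace of $\mathrm{M}$ there exists an isometry of $\mathrm{M}$ onto $\mathrm{M}$ extending $f$. It is universal if it is homogeneous and isometrically embeds every finite metric space $\mathrm{F}$ with $\operatorname{dist}(\mathrm{F})\subseteq \operatorname{dist}(\mathrm{M})$. A triple $(a,b,c)$ of non-negative numbers is metric if $a\leq b+c$, $b\leq a+c$ and $c\leq a+b$. Write $x\leadsto(a,b,c,d)$ if the triples $(x,a,b)$ and $(x,c,d)$ are metric and $a\geq \max\{b,c,d\}$. A set $R\subseteq\mathbb{R}_{\ge 0}$ satisfies the 4-values condition if for all $a,b,c,d\in R$ for which there is $x\in R$ with $x\leadsto(a,b,c,d)$ there is $y\in R$ with $y\leadsto(a,d,c,b)$. For every countable $R$ with $0\in R\subseteq\mathbb{R}_{\ge 0}$ satisfying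 the 4-values condition there is, up to isometry, a unique countable universal metric space with set of distances $R$; it is denoted $\boldsymbol{U}_R$.
   Formalization: In the "Moreover" part, 0 is also assumed to be a limit point of the set of distances of the universal separable space; without this the claim fails, e.g. for U_R with R = {0} ∪ {1+1/n : n ≥ 1}, which is its own completion and has non-closed distance set R. *)

theory Defs
  imports "HOL-Analysis.Analysis"
begin

definition distance_set :: "'a metric \<Rightarrow> real set" where
  "distance_set m = {mdist m x y | x y. x \<in> mspace m \<and> y \<in> mspace m}"

definition isometric_embedding :: "'a metric \<Rightarrow> 'b metric \<Rightarrow> ('a \<Rightarrow> 'b) \<Rightarrow> bool" where
  "isometric_embedding m m' f \<longleftrightarrow>
     f \<in> mspace m \<rightarrow> mspace m' \<and>
     (\<forall>x\<in>mspace m. \<forall>y\<in>mspace m. mdist m' (f x) (f y) = mdist m x y)"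

definition isometry_onto :: "'a metric \<Rightarrow> 'b metric \<Rightarrow> ('a \<Rightarrow> 'b) \<Rightarrow> bool" where
  "isometry_onto m m' f \<longleftrightarrow> isometric_embedding m m' f \<and> f ` mspace m = mspace m'"

definition homogeneous_metric :: "'a metric \<Rightarrow> bool" where
  "homogeneous_metric m \<longleftrightarrow>
     (\<forall>A f. finite A \<and> A \<subseteq> mspace m \<and> isometric_embedding (submetric m A) m f \<longrightarrow>
        (\<exists>g. isometry_onto m m g \<and> (\<forall>x\<in>A. g x = f x)))"

(* Every finite metric space is isometric to one whose points are natural numbers,
   so letting F range over nat metric covers finite metric spaces over any type. *)
definition universal_metric :: "'a metric \<Rightarrow> bool" where
  "universal_metric m \<longleftrightarrow>
     homogeneous_metric m \<and>
     (\<forall>F :: nat metric. finite (mspace F) \<and> distance_set F \<subseteq> distance_set m \<longrightarrow>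
        (\<exists>f. isometric_embedding F m f))"

(* The three inequalities together force a, b, c to be non-negative. *)
definition metric_triple :: "real \<Rightarrow> real \<Rightarrow> real \<Rightarrow> bool" where
  "metric_triple a b c \<longleftrightarrow> a \<le> b + c \<and> b \<le> a + c \<and> c \<le> a + b"

definition leads_to :: "real \<Rightarrow> real \<Rightarrow> real \<Rightarrow> real \<Rightarrow> real \<Rightarrow> bool" where
  "leads_to x a b c d \<longleftrightarrow>
     metric_triple x a b \<and> metric_triple x c d \<and> a \<ge> Max {b, c, d}"

definition four_values :: "real set \<Rightarrow> bool" where
  "four_values R \<longleftrightarrow>
     (\<forall>a\<in>R. \<forall>b\<in>R. \<forall>c\<in>R. \<forall>d\<in>R.
        (\<exists>x\<in>R. leads_to x a b c d) \<longrightarrow> (\<exists>y\<in>R. leads_to y a d c b))"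

(* The completion is determined up to isometry only: m' is a completion of m if m' is
   complete and contains an isometric copy of m as a dense subspace. *)
definition is_completion :: "'a metric \<Rightarrow> 'b metric \<Rightarrow> bool" where
  "is_completion m m' \<longleftrightarrow>
     mcomplete_of m' \<and>
     (\<exists>f. isometric_embedding m m' f \<and>
          mtopology_of m' closure_of (f ` mspace m) = mspace m')"

end

theory Submission
  imports Defs
begin

text \<open>
  Both parts come from one fact: if \<open>m\<close> is universal, \<open>R\<close> is its set of distances and \<open>0\<close> is a limit
  point of \<open>R\<close>, then every completion of \<open>m\<close> has distance set \<open>closure R\<close>. By density, distances of
  the completion are limits of distances of \<open>m\<close>, so the point is to realise every \<open>r\<close> in
  \<open>closure R\<close> (\<open>closure_subset_distance_set_completion\<close>).

  Let \<open>r > 0\<close>, the case \<open>r = 0\<close> being trivial. Since \<open>0\<close> is a limit point of \<open>R\<close>, there are positive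
  \<open>s\<^sub>n \<in> R\<close> that at least halve at each step, with all \<open>s\<^sub>n \<le> r\<close>, and then there are \<open>r\<^sub>n \<in> R\<close> with
  \<open>\<bar>r\<^sub>n - r\<bar> < s\<^sub>n / 2\<close>. The numbers \<open>r\<^sub>n\<close>, \<open>r\<^sub>n\<^sub>+\<^sub>1\<close>, \<open>s\<^sub>n\<close> are then the side lengths of a triangle.
  Universality embeds such a triangle into \<open>m\<close>, and homogeneity moves one of its sides onto any given
  pair of points at the right distance (\<open>universal_metric_third_point\<close>). So, starting from points
  \<open>x\<close>, \<open>y\<^sub>0\<close> at distance \<open>r\<^sub>0\<close>, there are successive \<open>y\<^sub>n\<close> at distance \<open>r\<^sub>n\<close> from the fixed point \<open>x\<close> and
  with \<open>y\<^sub>n\<close>, \<open>y\<^sub>n\<^sub>+\<^sub>1\<close> at distance \<open>s\<^sub>n\<close>. As the \<open>s\<^sub>n\<close> decrease geometrically, \<open>y\<close> is a Cauchy sequence;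
  in the completion it has a limit, which lies at distance \<open>r\<close> from \<open>x\<close>.
\<close>

section \<open>Distance sets and isometric embeddings\<close>

lemma mdist_self: "x \<in> mspace m \<Longrightarrow> mdist m x x = 0"
  using mdist_zero[of x m x] by simp

lemma distance_setI: "x \<in> mspace m \<Longrightarrow> y \<in> mspace m \<Longrightarrow> mdist m x y \<in> distance_set m"
  by (auto simp: distance_set_def)

lemma zero_in_distance_set: "x \<in> mspace m \<Longrightarrow> 0 \<in> distance_set m"
  using distance_setI[of x m x] by (simp add: mdist_self)

lemma distance_set_nonneg: "r \<in> distance_set m \<Longrightarrow> 0 \<le> r"
  by (auto simp: distance_set_def)

lemma isometric_embedding_mspace: "isometric_embedding m m' f \<Longrightarrow> x \<in> mspace m \<Longrightarrow> f x \<in> mspace m'"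
  by (auto simp: isometric_embedding_def)

lemma isometric_embedding_mdist:
  "isometric_embedding m m' f \<Longrightarrow> x \<in> mspace m \<Longrightarrow> y \<in> mspace m \<Longrightarrow> mdist m' (f x) (f y) = mdist m x y"
  by (auto simp: isometric_embedding_def)

section \<open>Triangles in universal metric spaces\<close>

lemma universal_metric_triangle:
  assumes m: "universal_metric m"
    and in_dist: "a \<in> distance_set m" "b \<in> distance_set m" "s \<in> distance_set m"
    and pos: "0 < a" "0 < b" "0 < s"
    and tri: "metric_triple a b s"
  obtains p q z where "p \<in> mspace m" "q \<in> mspace m" "z \<in> mspace m"
    "mdist m p q = a" "mdist m p z = b" "mdist m q z = s"
proof -
  \<comment> \<open>The sides of a triangle with vertices 0, 1, 2 are told apart by the sums of their endpoints.\<close>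
  define d :: "nat \<Rightarrow> nat \<Rightarrow> real"
    where "d i j = (if i = j then 0 else if i + j = 1 then a else if i + j = 2 then b else s)" for i j
  have side: "d 0 (Suc 0) = a" "d (Suc 0) 0 = a" "d 0 2 = b" "d 2 0 = b" "d (Suc 0) 2 = s" "d 2 (Suc 0) = s"
    and diag: "d i i = 0" for i
    by (simp_all add: d_def)
  have T: "Metric_space {0, 1, 2} d"
  proof
    show "0 \<le> d i j" for i j
      using pos by (simp add: d_def)
    show "d i j = d j i" for i j
      by (simp add: d_def add.commute)
    show "d i j = 0 \<longleftrightarrow> i = j" for i j
      using pos by (simp add: d_def)
    show "d i k \<le> d i j + d j k" if "i \<in> {0, 1, 2}" "j \<in> {0, 1, 2}" "k \<in> {0, 1, 2}" for i j k
      using that pos tri by (auto simp: side diag metric_triple_def)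
  qed
  define F where "F = metric ({0, 1, 2::nat}, d)"
  have F: "mspace F = {0, 1, 2}" "mdist F = d"
    unfolding F_def by (rule Metric_space.mspace_metric[OF T] Metric_space.mdist_metric[OF T])+
  have "0 \<in> distance_set m"
    using in_dist(1) zero_in_distance_set[of _ m] unfolding distance_set_def[of m] by blast
  then have "distance_set F \<subseteq> distance_set m"
    using in_dist by (auto simp: distance_set_def[of F] F d_def)
  moreover have "finite (mspace F)"
    by (simp add: F)
  ultimately obtain g where g: "isometric_embedding F m g"
    using m unfolding universal_metric_def by blast
  show ?thesis
    by (rule that[of "g 0" "g 1" "g 2"])
      (simp_all add: isometric_embedding_mspace[OF g] isometric_embedding_mdist[OF g] F side)
qed

text \<open>
  The one-point extension property for two given points: \<open>universal_metric_triangle\<close> produces a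
  triangle somewhere in the space, and a global isometry carries its first side to \<open>x\<close>, \<open>y\<close>.
\<close>

lemma universal_metric_third_point:
  assumes m: "universal_metric m"
    and xy: "x \<in> mspace m" "y \<in> mspace m"
    and in_dist: "b \<in> distance_set m" "s \<in> distance_set m"
    and pos: "0 < mdist m x y" "0 < b" "0 < s"
    and tri: "metric_triple (mdist m x y) b s"
  obtains z where "z \<in> mspace m" "mdist m x z = b" "mdist m y z = s"
proof -
  obtain p q w where pqw: "p \<in> mspace m" "q \<in> mspace m" "w \<in> mspace m"
    and side: "mdist m p q = mdist m x y" and w: "mdist m p w = b" "mdist m q w = s"
    using universal_metric_triangle[OF m distance_setI[OF xy] in_dist pos tri] by metis
  define f where "f u = (if u = p then x else y)" for u
  have "p \<noteq> q"
    using side pos(1) pqw by (auto simp: mdist_self)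
  have "isometric_embedding (submetric m {p, q}) m f"
    using \<open>p \<noteq> q\<close> pqw xy side
    by (auto simp: isometric_embedding_def f_def mdist_commute mdist_self)
  then obtain h where h: "isometry_onto m m h" and hf: "\<forall>u\<in>{p, q}. h u = f u"
    using m pqw unfolding universal_metric_def homogeneous_metric_def
    by (metis bot.extremum finite.emptyI finite.insertI insert_subset)
  have h': "isometric_embedding m m h"
    using h by (simp add: isometry_onto_def)
  have "h p = x" "h q = y"
    using hf \<open>p \<noteq> q\<close> by (auto simp: f_def)
  then show ?thesis
    using that[of "h w"] isometric_embedding_mspace[OF h' pqw(3)]
      isometric_embedding_mdist[OF h' pqw(1,3)] isometric_embedding_mdist[OF h' pqw(2,3)] w
    by simp
qed

section \<open>Sequences with geometrically decreasing steps\<close>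

lemma halving_tendsto_0:
  fixes s :: "nat \<Rightarrow> real"
  assumes half: "\<And>n. s (Suc n) \<le> s n / 2" and pos: "\<And>n. 0 < s n"
  shows "s \<longlonglongrightarrow> 0"
proof (rule tendsto_sandwich)
  have s: "s n \<le> s 0 * (1/2) ^ n" for n
  proof (induction n)
    case (Suc n)
    then show ?case using half[of n] by simp
  qed simp
  then show "\<forall>\<^sub>F n in sequentially. s n \<le> s 0 * (1/2) ^ n"
    by simp
  show "\<forall>\<^sub>F n in sequentially. 0 \<le> s n"
    using pos by (simp add: less_imp_le)
  show "(\<lambda>n. s 0 * (1/2) ^ n) \<longlonglongrightarrow> 0"
    by (intro tendsto_mult_right_zero LIMSEQ_power_zero) auto
qed simp

lemma MCauchy_if_dist_Suc_geometric:
  assumes y: "\<And>n. y n \<in> mspace m"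
    and step_le: "\<And>n. mdist m (y n) (y (Suc n)) \<le> s n"
    and half: "\<And>n. s (Suc n) \<le> s n / 2"
    and pos: "\<And>n. 0 < s n"
  shows "Metric_space.MCauchy (mspace m) (mdist m) y"
proof -
  \<comment> \<open>The bound telescopes because \<open>s n \<le> 2 * s n - 2 * s (Suc n)\<close>.\<close>
  have dist_le: "mdist m (y n) (y k) \<le> 2 * s n - 2 * s k" if "n \<le> k" for n k
    using that
  proof (induction rule: dec_induct)
    case base
    show ?case using y by (simp add: mdist_self)
  next
    case (step k)
    then show ?case
      using mdist_triangle[OF y y y, of n "Suc k" k] step_le[of k] half[of k] by linarith
  qed
  have small: "\<exists>n. s n < e" if "0 < e" for e
    using order_tendstoD(2)[OF halving_tendsto_0[of s, OF half pos] that]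
    by (auto simp: eventually_sequentially)
  show ?thesis
    unfolding Metric_space.MCauchy_def[OF Metric_space_mspace_mdist]
  proof (intro conjI allI impI)
    show "range y \<subseteq> mspace m"
      using y by auto
    fix e :: real
    assume "0 < e"
    then obtain K where K: "s K < e / 4"
      using small[of "e / 4"] by auto
    have "mdist m (y n) (y n') < e" if "K \<le> n" "K \<le> n'" for n n'
      using mdist_triangle[OF y y y, of n n' K] mdist_commute[of m "y n" "y K"]
        dist_le[OF that(1)] dist_le[OF that(2)] pos[of n] pos[of n'] K
      by linarith
    then show "\<exists>K. \<forall>n n'. K \<le> n \<longrightarrow> K \<le> n' \<longrightarrow> mdist m (y n) (y n') < e"
      by blast
  qed
qed

section \<open>Distances of the completion\<close>

lemma distance_set_dense_subset_closure:
  assumes f: "isometric_embedding m m' f"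
    and dense: "mtopology_of m' closure_of (f ` mspace m) = mspace m'"
  shows "distance_set m' \<subseteq> closure (distance_set m)"
proof
  have near: "\<exists>x\<in>mspace m. mdist m' u (f x) < e" if "u \<in> mspace m'" "0 < e" for u e
  proof -
    have "u \<in> mtopology_of m' closure_of (f ` mspace m)"
      using that dense by simp
    then show ?thesis
      using that
      unfolding mtopology_of_def Metric_space.metric_closure_of[OF Metric_space_mspace_mdist]
      by (auto simp: Metric_space.in_mball)
  qed
  fix r
  assume "r \<in> distance_set m'"
  then obtain u v where uv: "u \<in> mspace m'" "v \<in> mspace m'" and r: "r = mdist m' u v"
    by (auto simp: distance_set_def)
  show "r \<in> closure (distance_set m)"
    unfolding closure_approachable
  proof (intro allI impI)
    fix e :: real
    assume "0 < e"
    then obtain x y where xy: "x \<in> mspace m" "y \<in> mspace m"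
      and close: "mdist m' u (f x) < e / 2" "mdist m' v (f y) < e / 2"
      using near[OF uv(1), of "e / 2"] near[OF uv(2), of "e / 2"] by auto
    note fxy = xy[THEN isometric_embedding_mspace[OF f]]
    have "dist (mdist m x y) r < e"
      unfolding dist_real_def r isometric_embedding_mdist[OF f xy, symmetric]
      using mdist_triangle[OF uv(1) fxy(1) uv(2)] mdist_triangle[OF fxy(1,2) uv(2)]
        mdist_triangle[OF fxy(1) uv(1) fxy(2)] mdist_triangle[OF uv fxy(2)]
        close mdist_commute[of m' u "f x"] mdist_commute[of m' v "f y"]
      by linarith
    then show "\<exists>t\<in>distance_set m. dist t r < e"
      using distance_setI[OF xy] by blast
  qed
qed

text \<open>
  One point of the pair realising \<open>r\<close> stays in \<open>m\<close>; the other is the limit of a path of points of \<open>m\<close>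
  whose distances to the first one are the approximations \<open>\<rho> n\<close> of \<open>r\<close> and whose steps have the
  lengths \<open>s n\<close>. Any metric space that is complete and contains a copy of \<open>m\<close> has such a limit.
\<close>

lemma closure_subset_distance_set_completion:
  assumes m: "universal_metric m"
    and lim0: "0 islimpt distance_set m"
    and complete: "mcomplete_of m'"
    and f: "isometric_embedding m m' f"
  shows "closure (distance_set m) \<subseteq> distance_set m'"
proof
  let ?R = "distance_set m"
  have small: "\<exists>s\<in>?R. 0 < s \<and> s \<le> e" if e: "0 < e" for e
  proof -
    obtain s where "s \<in> ?R" "s \<noteq> 0" "dist s 0 < e"
      using lim0 e unfolding islimpt_approachable by blast
    then show ?thesis
      using distance_set_nonneg[of s m] by (intro bexI[of _ s]) auto
  qed
  fix r
  assume r: "r \<in> closure ?R"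
  have "0 \<le> r"
    using closure_minimal[OF _ closed_atLeast, of ?R 0] r distance_set_nonneg[of _ m] by blast
  show "r \<in> distance_set m'"
  proof (cases "r = 0")
    case True
    obtain x where "x \<in> mspace m"
      using small[of 1] by (auto simp: distance_set_def)
    then have "f x \<in> mspace m'"
      by (rule isometric_embedding_mspace[OF f])
    then show ?thesis
      using zero_in_distance_set True by simp
  next
    case False
    with \<open>0 \<le> r\<close> have "0 < r" by simp
    \<comment> \<open>The bound \<open>s n \<le> r\<close> is for positivity of \<open>\<rho> n\<close> and for \<open>s n \<le> \<rho> n + \<rho> (Suc n)\<close>.\<close>
    have "\<exists>s. \<forall>n. (s n \<in> ?R \<and> 0 < s n \<and> s n \<le> r) \<and> s (Suc n) \<le> s n / 2"
    proof (rule dependent_nat_choice)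
      show "\<exists>s. s \<in> ?R \<and> 0 < s \<and> s \<le> r"
        using small[OF \<open>0 < r\<close>] by blast
      fix t :: real and n :: nat
      assume t: "t \<in> ?R \<and> 0 < t \<and> t \<le> r"
      then show "\<exists>s. (s \<in> ?R \<and> 0 < s \<and> s \<le> r) \<and> s \<le> t / 2"
        using small[of "t / 2"] by fastforce
    qed
    then obtain s where s: "\<And>n. s n \<in> ?R" "\<And>n. 0 < s n" "\<And>n. s n \<le> r"
      and half: "\<And>n. s (Suc n) \<le> s n / 2"
      by blast
    have "\<forall>n. \<exists>t\<in>?R. dist t r < s n / 2"
      using r s(2) unfolding closure_approachable by (blast intro: half_gt_zero)
    then obtain \<rho> where \<rho>: "\<And>n. \<rho> n \<in> ?R" and \<rho>r: "\<And>n. \<bar>\<rho> n - r\<bar> < s n / 2"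
      unfolding dist_real_def by metis
    have \<rho>_pos: "0 < \<rho> n" for n
      using \<rho>r[of n] s(3)[of n] \<open>0 < r\<close> by linarith
    \<comment> \<open>\<open>\<bar>\<rho> n - \<rho> (Suc n)\<bar> < s n / 2 + s (Suc n) / 2 \<le> s n\<close>.\<close>
    have tri: "metric_triple (\<rho> n) (\<rho> (Suc n)) (s n)" for n
      unfolding metric_triple_def
      using \<rho>r[of n] \<rho>r[of "Suc n"] half[of n] s(3)[of n] s(2)[of n] s(2)[of "Suc n"] by linarith
    obtain x y0 where x: "x \<in> mspace m" and y0: "y0 \<in> mspace m" "mdist m x y0 = \<rho> 0"
      using \<rho>[of 0] by (auto simp: distance_set_def)
    have "\<exists>y. \<forall>n. (y n \<in> mspace m \<and> mdist m x (y n) = \<rho> n) \<and> mdist m (y n) (y (Suc n)) = s n"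
    proof (rule dependent_nat_choice)
      show "\<exists>y. y \<in> mspace m \<and> mdist m x y = \<rho> 0"
        using y0 by blast
      fix y n
      assume y: "y \<in> mspace m \<and> mdist m x y = \<rho> n"
      then obtain z where "z \<in> mspace m" "mdist m x z = \<rho> (Suc n)" "mdist m y z = s n"
        using universal_metric_third_point[OF m x _ \<rho> s(1) _ \<rho>_pos s(2), of y "Suc n" n]
          tri[of n] \<rho>_pos[of n]
        by auto
      then show "\<exists>z. (z \<in> mspace m \<and> mdist m x z = \<rho> (Suc n)) \<and> mdist m y z = s n"
        by blast
    qed
    then obtain y where y: "\<And>n. y n \<in> mspace m" "\<And>n. mdist m x (y n) = \<rho> n"
      and step: "\<And>n. mdist m (y n) (y (Suc n)) = s n"
      by blast
    have fx: "f x \<in> mspace m'" and fy: "f (y n) \<in> mspace m'" for n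
      using x y(1) isometric_embedding_mspace[OF f] by auto
    have "Metric_space.MCauchy (mspace m') (mdist m') (\<lambda>n. f (y n))"
      by (rule MCauchy_if_dist_Suc_geometric[of _ _ s])
        (use fy half s(2) step isometric_embedding_mdist[OF f y(1) y(1)] in auto)
    then obtain l where l: "limitin (mtopology_of m') (\<lambda>n. f (y n)) l sequentially"
      using complete
      unfolding mcomplete_of_def mtopology_of_def Metric_space.mcomplete_def[OF Metric_space_mspace_mdist]
      by blast
    then have l_in: "l \<in> mspace m'" and l_lim: "(\<lambda>n. mdist m' (f (y n)) l) \<longlonglongrightarrow> 0"
      unfolding mtopology_of_def Metric_space.limitin_metric_dist_null[OF Metric_space_mspace_mdist]
      by auto
    have "\<rho> \<longlonglongrightarrow> r"
    proof (rule LIM_zero_cancel, rule Lim_null_comparison[OF _ halving_tendsto_0[of s, OF half s(2)]])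
      have "norm (\<rho> n - r) \<le> s n" for n
        using \<rho>r[of n] s(2)[of n] by simp
      then show "\<forall>\<^sub>F n in sequentially. norm (\<rho> n - r) \<le> s n"
        by simp
    qed
    moreover have "\<rho> \<longlonglongrightarrow> mdist m' (f x) l"
    proof (rule LIM_zero_cancel, rule Lim_null_comparison[OF _ l_lim])
      show "\<forall>\<^sub>F n in sequentially. norm (\<rho> n - mdist m' (f x) l) \<le> mdist m' (f (y n)) l"
        using Metric_space.mdist_reverse_triangle[OF Metric_space_mspace_mdist fy fx l_in]
          isometric_embedding_mdist[OF f x y(1)] y(2) fx fy l_in
        by (simp add: mdist_commute)
    qed
    ultimately have "r = mdist m' (f x) l"
      by (rule LIMSEQ_unique)
    then show ?thesis
      using distance_setI[OF fx l_in] by simp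
  qed
qed

theorem distance_set_completion:
  assumes "universal_metric m" "0 islimpt distance_set m" "is_completion m m'"
  shows "distance_set m' = closure (distance_set m)"
  using assms closure_subset_distance_set_completion distance_set_dense_subset_closure
  unfolding is_completion_def by (metis subset_antisym)

theorem corollary4p1:
  fixes R :: "real set"
    and U :: "'a metric" and M :: "'b metric"
    and V :: "'c metric" and N :: "'d metric"
  shows "(0 \<in> R \<and> R \<subseteq> {0..} \<and> countable R \<and> four_values R \<and> 0 islimpt R \<and>
          countable (mspace U) \<and> universal_metric U \<and> distance_set U = R \<and>
          is_completion U M
            \<longrightarrow> distance_set M = closure R) \<and>
         (universal_metric V \<and> separable_space (mtopology_of V) \<and>
          0 islimpt distance_set V \<and> is_completion V N
            \<longrightarrow> closed (distance_set N))"
  using distance_set_completion[of U M] distance_set_completion[of V N] closed_closure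
  by metis

end
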